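(* There exist infinitely many atomic Puiseux monoids that are not strongly bounded.
   Context: A Puiseux monoid is an additive submonoid of $\mathbb{Q}_{\ge 0}$. For $r\in\mathbb{Q}_{>0}$, $\mathsf{n}(r)$ is the numerator of $r$ written in lowest terms with positive numerator and denominator. A set $S$ of positive rationals is strongly bounded if $\{\mathsf{n}(s)\mid s\in S\}$ is bounded. A Puiseux monoid is strongly bounded if it can be generated (as a monoid) by a strongly bounded set. An atom of $M$ is a nonzero $a\in M$ such that $a=x+y$ with $x,y\in M$ implies $x=0$ or $y=0$; $M$ is atomic if every nonzero element of $M$ is a finite sum of atoms. *)

theory Defs
  imports Complex_Main
begin

definition puiseux_monoid :: "rat set \<Rightarrow> bool" where
  "puiseux_monoid M \<longleftrightarrow>
     M \<subseteq> {0..} \<and> 0 \<in> M \<and> (\<forall>x\<in>M. \<forall>y\<in>M. x + y \<in> M)"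

definition rat_numerator :: "rat \<Rightarrow> int" where
  "rat_numerator r = fst (quotient_of r)"

definition strongly_bounded_set :: "rat set \<Rightarrow> bool" where
  "strongly_bounded_set S \<longleftrightarrow> S \<subseteq> {0<..} \<and> bdd_above (rat_numerator ` S)"

(* For S contained in the positive rationals, puiseux_monoid hull S (HOL.Hull) is the
   intersection of all Puiseux monoids containing S, which is the submonoid generated by S. *)
definition strongly_bounded_monoid :: "rat set \<Rightarrow> bool" where
  "strongly_bounded_monoid M \<longleftrightarrow>
     (\<exists>S. strongly_bounded_set S \<and> M = puiseux_monoid hull S)"

definition monoid_atoms :: "rat set \<Rightarrow> rat set" where
  "monoid_atoms M =
     {a \<in> M. a \<noteq> 0 \<and> (\<forall>x\<in>M. \<forall>y\<in>M. a = x + y \<longrightarrow> x = 0 \<or> y = 0)}"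

definition atomic_monoid :: "rat set \<Rightarrow> bool" where
  "atomic_monoid M \<longleftrightarrow>
     (\<forall>x\<in>M. x \<noteq> 0 \<longrightarrow> (\<exists>as. set as \<subseteq> monoid_atoms M \<and> x = sum_list as))"

end

theory Submission
  imports Defs
begin

text \<open>
  For a rational number \<open>c > 0\<close>, the rationals that are \<open>0\<close> or at least \<open>c\<close> form a Puiseux
  monoid. A sum of two of its nonzero elements is at least \<open>2 * c\<close>, so every rational in
  \<open>[c, 2 * c)\<close> is an atom; and an element \<open>x \<ge> c\<close> is a sum of \<open>\<lfloor>x / c\<rfloor>\<close> copies of one
  such atom. Hence the monoid is atomic. An atom cannot be produced from other elements,
  so it lies in every generating set (\<open>monoid_atoms_subset_generators\<close>). For \<open>c = m\<close> a positive
  integer, the atoms \<open>m + 1 / k\<close> with \<open>k > 1\<close> have numerators \<open>m * k + 1\<close>, so the numerators in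
  any generating set are unbounded. Distinct \<open>m\<close> give distinct monoids, because \<open>m\<close> is the
  least nonzero element.
\<close>

text \<open>The argument: removing an atom leaves a submonoid, which would still contain the
  generators if the atom were not one of them.\<close>

lemma monoid_atoms_subset_generators:
  assumes M: "puiseux_monoid M" and gen: "M = puiseux_monoid hull S"
  shows "monoid_atoms M \<subseteq> S"
proof
  fix a
  assume a: "a \<in> monoid_atoms M"
  show "a \<in> S"
  proof (rule ccontr)
    assume "a \<notin> S"
    moreover have "S \<subseteq> M"
      unfolding gen by (rule hull_subset)
    ultimately have "S \<subseteq> M - {a}" by blast
    moreover have "puiseux_monoid (M - {a})"
      unfolding puiseux_monoid_def
    proof (intro conjI ballI)
      show "M - {a} \<subseteq> {0..}" and "0 \<in> M - {a}"
        using M a by (auto simp: puiseux_monoid_def monoid_atoms_def)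
    next
      fix x y
      assume x: "x \<in> M - {a}" and y: "y \<in> M - {a}"
      have "x + y \<noteq> a"
      proof
        assume "x + y = a"
        with a x y have "x = 0 \<or> y = 0" unfolding monoid_atoms_def by blast
        with \<open>x + y = a\<close> x y show False by auto
      qed
      with M x y show "x + y \<in> M - {a}" by (auto simp: puiseux_monoid_def)
    qed
    ultimately have "M \<subseteq> M - {a}"
      unfolding gen by (rule hull_minimal)
    with a show False by (auto simp: monoid_atoms_def)
  qed
qed

definition gap_monoid :: "rat \<Rightarrow> rat set" where
  "gap_monoid c = insert 0 {c..}"

lemma puiseux_monoid_gap_monoid:
  assumes "c > 0"
  shows "puiseux_monoid (gap_monoid c)"
  using assms by (auto simp: puiseux_monoid_def gap_monoid_def)

lemma atoms_gap_monoid: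
  assumes "c > 0"
  shows "{c..<2 * c} \<subseteq> monoid_atoms (gap_monoid c)"
  using assms by (auto simp: monoid_atoms_def gap_monoid_def)

lemma atomic_gap_monoid:
  assumes c: "c > 0"
  shows "atomic_monoid (gap_monoid c)"
  unfolding atomic_monoid_def
proof (intro ballI impI)
  fix x
  assume "x \<in> gap_monoid c" and "x \<noteq> 0"
  then have x: "x \<ge> c" by (simp add: gap_monoid_def)
  define k where "k = nat \<lfloor>x / c\<rfloor>"
  have "\<lfloor>x / c\<rfloor> \<ge> 1" using c x by (simp add: le_floor_iff)
  then have k1: "k \<ge> 1" and k: "of_nat k = (of_int \<lfloor>x / c\<rfloor> :: rat)"
    unfolding k_def by linarith+
  have k1': "(of_nat k :: rat) \<ge> 1" using k1 by simp
  have "of_nat k \<le> x / c" "x / c < of_nat k + 1"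
    unfolding k by (rule of_int_floor_le floor_correct[THEN conjunct2, simplified])+
  then have lower: "of_nat k * c \<le> x" and "x < (of_nat k + 1) * c"
    using c by (simp_all add: field_simps)
  moreover have "(of_nat k + 1) * c \<le> (2 * of_nat k) * c"
    using c k1' by (intro mult_right_mono) auto
  ultimately have "x < 2 * of_nat k * c" by linarith
  with lower have "x / of_nat k \<in> {c..<2 * c}"
    using k1' by (simp add: field_simps)
  with atoms_gap_monoid[OF c] have "set (replicate k (x / of_nat k)) \<subseteq> monoid_atoms (gap_monoid c)"
    by auto
  moreover have "x = sum_list (replicate k (x / of_nat k))"
    using k1 by (simp add: sum_list_replicate)
  ultimately show "\<exists>as. set as \<subseteq> monoid_atoms (gap_monoid c) \<and> x = sum_list as" by blast
qed

lemma rat_numerator_int_plus_inverse: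
  assumes "k > 0"
  shows "rat_numerator (of_int m + 1 / of_int k) = m * k + 1"
proof -
  have "of_int m + 1 / of_int k = Fract (m * k + 1) k"
    using assms by (simp add: Fract_of_int_quotient field_simps)
  moreover have "coprime (m * k + 1) k"
    by (metis coprime_1_left coprime_iff_gcd_eq_1 gcd.commute gcd_add_mult mult.commute add.commute)
  ultimately show ?thesis
    using assms by (simp add: rat_numerator_def quotient_of_Fract normalize_def)
qed

lemma not_strongly_bounded_gap_monoid:
  assumes m: "m > 0"
  shows "\<not> strongly_bounded_monoid (gap_monoid (of_int m))"
proof
  assume "strongly_bounded_monoid (gap_monoid (of_int m))"
  then obtain S where S: "strongly_bounded_set S"
    and gen: "gap_monoid (of_int m) = puiseux_monoid hull S"
    by (auto simp: strongly_bounded_monoid_def)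
  from S obtain B where B: "\<And>s. s \<in> S \<Longrightarrow> rat_numerator s \<le> B"
    by (auto simp: strongly_bounded_set_def bdd_above_def)
  (* The bound k >= 2 keeps m + 1 / k below 2 * m also for m = 1. *)
  define k where "k = max B 2"
  have k: "k \<ge> 2" "k \<ge> B" by (simp_all add: k_def)
  have m': "(of_int m :: rat) > 0" "(of_int m :: rat) \<ge> 1" using m by simp_all
  have "(1 :: rat) / of_int k < 1" "(0 :: rat) < 1 / of_int k" using k by simp_all
  then have "of_int m + 1 / of_int k \<in> {of_int m..<2 * (of_int m :: rat)}"
    using m'(2) unfolding atLeastLessThan_iff by linarith
  then have "of_int m + 1 / of_int k \<in> S"
    using atoms_gap_monoid[OF m'(1)]
      monoid_atoms_subset_generators[OF puiseux_monoid_gap_monoid[OF m'(1)] gen] by blast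
  then have "m * k + 1 \<le> B"
    using B[of "of_int m + 1 / of_int k"] rat_numerator_int_plus_inverse[of k m] k by simp
  moreover have "1 * k \<le> m * k" using m k by (intro mult_right_mono) auto
  ultimately show False using k by simp
qed

lemma inj_on_gap_monoid: "inj_on gap_monoid {0<..}"
proof (rule inj_onI)
  fix c d :: rat
  assume pos: "c \<in> {0<..}" "d \<in> {0<..}" and eq: "gap_monoid c = gap_monoid d"
  have "c \<in> gap_monoid d" unfolding eq[symmetric] by (simp add: gap_monoid_def)
  moreover have "d \<in> gap_monoid c" unfolding eq by (simp add: gap_monoid_def)
  ultimately show "c = d" using pos unfolding gap_monoid_def by auto
qed

theorem proposition4p2:
  shows "infinite {M. puiseux_monoid M \<and> atomic_monoid M \<and> \<not> strongly_bounded_monoid M}"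
proof -
  have "inj_on (\<lambda>m. gap_monoid (of_int m)) {0 :: int<..}"
    by (rule inj_onI) (auto dest!: inj_onD[OF inj_on_gap_monoid])
  then have "infinite ((\<lambda>m. gap_monoid (of_int m)) ` {0 :: int<..})"
    by (simp add: finite_image_iff infinite_Ioi)
  moreover have "(\<lambda>m. gap_monoid (of_int m)) ` {0 :: int<..}
      \<subseteq> {M. puiseux_monoid M \<and> atomic_monoid M \<and> \<not> strongly_bounded_monoid M}"
    by (auto intro: puiseux_monoid_gap_monoid atomic_gap_monoid
        simp: not_strongly_bounded_gap_monoid)
  ultimately show ?thesis by (rule infinite_super[rotated])
qed

end
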